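(* Let $\{X_\alpha\}_{\alpha\in A}$ and $\{Y_\alpha\}_{\alpha\in A}$ be arbitrary families of nonempty metric spaces (with $A\neq\emptyset$) such that $\sup_{\alpha\in A}\operatorname{diam}(X_\alpha)<\infty$ and $\sup_{\alpha\in A}\operatorname{diam}(Y_\alpha)<\infty$. Then $$\sup_{\alpha\in A}\Bigl(d_{GH}(X_\alpha,Y_\alpha)-\frac12\sup_{\beta\ne\alpha}\operatorname{diam}(X_\beta)-\frac12\sup_{\beta\neq\alpha}\operatorname{diam}(Y_\beta)\Bigr)\le d_{GH}\Bigl((l^\infty)\prod_{\alpha\in A}X_\alpha,\ (l^\infty)\prod_{\alpha\in A}Y_\alpha\Bigr)\le\sup_{\alpha\in A}d_{GH}(X_\alpha,Y_\alpha).$$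
   Context: $\operatorname{diam}(X)=\sup_{x,y\in X}d_X(x,y)$; a supremum of diameters over an empty index set is $0$. A correspondence between metric spaces $X$ and $Y$ is a subset $R\subset X\times Y$ whose projections to $X$ and to $Y$ are surjective; $\mathcal R(X,Y)$ is the set of all correspondences. Its distortion is $\operatorname{dis}R=\sup\{|d_X(x,x')-d_Y(y,y')| : (x,y),(x',y')\in R\}$. The Gromov--Hausdorff distance is $d_{GH}(X,Y)=\frac12\inf\{\operatorname{dis}R: R\in\mathcal R(X,Y)\}$. For a family $\{(X_\alpha,d_\alpha)\}_{\alpha\in A}$ of metric spaces with $\sup_\alpha\operatorname{diam}(X_\alpha)<\infty$, the $l^\infty$-product $(l^\infty)\prod_{\alpha\in A}X_\alpha$ is the Cartesian product $\prod_{\alpha\in A}X_\alpha$ with metric $d(\{x_\alpha\},\{y_\alpha\})=\sup_{\alpha\in A}d_\alpha(x_\alpha,y_\alpha)$. *)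

theory Defs
  imports "HOL-Analysis.Analysis"
begin

text \<open>
  Diameters, distortions and Gromov--Hausdorff distances are \<^typ>\<open>ennreal\<close>-valued: they may be
  infinite, and the supremum of the empty set is 0.
\<close>

definition mdiameter :: "'a metric \<Rightarrow> ennreal" where
  "mdiameter X = (SUP (x, x') \<in> mspace X \<times> mspace X. ennreal (mdist X x x'))"

definition correspondences :: "'a metric \<Rightarrow> 'b metric \<Rightarrow> ('a \<times> 'b) set set" where
  "correspondences X Y =
     {R. R \<subseteq> mspace X \<times> mspace Y \<and> fst ` R = mspace X \<and> snd ` R = mspace Y}"

definition distortion :: "'a metric \<Rightarrow> 'b metric \<Rightarrow> ('a \<times> 'b) set \<Rightarrow> ennreal" where
  "distortion X Y R =
     (SUP ((x, y), (x', y')) \<in> R \<times> R. ennreal \<bar>mdist X x x' - mdist Y y y'\<bar>)"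

definition gromov_hausdorff_dist :: "'a metric \<Rightarrow> 'b metric \<Rightarrow> ennreal" where
  "gromov_hausdorff_dist X Y = (INF R \<in> correspondences X Y. distortion X Y R) / 2"

text \<open>
  The value 0 outside the carrier is forced by \<^locale>\<open>Metric_space\<close>, which demands
  nonnegativity and symmetry of the distance function on the whole type.
\<close>

definition linf_dist :: "'i set \<Rightarrow> ('i \<Rightarrow> 'a metric) \<Rightarrow> ('i \<Rightarrow> 'a) \<Rightarrow> ('i \<Rightarrow> 'a) \<Rightarrow> real" where
  "linf_dist A X x y =
     (if x \<in> (\<Pi>\<^sub>E \<alpha>\<in>A. mspace (X \<alpha>)) \<and> y \<in> (\<Pi>\<^sub>E \<alpha>\<in>A. mspace (X \<alpha>))
      then SUP \<alpha>\<in>A. mdist (X \<alpha>) (x \<alpha>) (y \<alpha>) else 0)"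

text \<open>
  This is the intended metric space only for nonempty \<open>A\<close> and uniformly bounded diameters;
  see \<open>mspace_linf_product\<close> and \<open>mdist_linf_product\<close> below.
\<close>

definition linf_product :: "'i set \<Rightarrow> ('i \<Rightarrow> 'a metric) \<Rightarrow> ('i \<Rightarrow> 'a) metric" where
  "linf_product A X = metric (\<Pi>\<^sub>E \<alpha>\<in>A. mspace (X \<alpha>), linf_dist A X)"

lemma bdd_above_linf:
  assumes fin: "(SUP \<alpha>\<in>A. mdiameter (X \<alpha>)) < \<infinity>"
    and x: "x \<in> (\<Pi>\<^sub>E \<alpha>\<in>A. mspace (X \<alpha>))" and y: "y \<in> (\<Pi>\<^sub>E \<alpha>\<in>A. mspace (X \<alpha>))"
  shows "bdd_above ((\<lambda>\<alpha>. mdist (X \<alpha>) (x \<alpha>) (y \<alpha>)) ` A)"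
proof -
  obtain r where r: "0 \<le> r" "(SUP \<alpha>\<in>A. mdiameter (X \<alpha>)) = ennreal r"
    using fin by (cases "SUP \<alpha>\<in>A. mdiameter (X \<alpha>)" rule: ennreal_cases) auto
  have "mdist (X \<alpha>) (x \<alpha>) (y \<alpha>) \<le> r" if "\<alpha> \<in> A" for \<alpha>
  proof -
    have "x \<alpha> \<in> mspace (X \<alpha>)" "y \<alpha> \<in> mspace (X \<alpha>)" using x y that by auto
    then have "ennreal (mdist (X \<alpha>) (x \<alpha>) (y \<alpha>)) \<le> mdiameter (X \<alpha>)"
      unfolding mdiameter_def by (intro SUP_upper2[of "(x \<alpha>, y \<alpha>)"]) auto
    also have "\<dots> \<le> ennreal r" unfolding r(2)[symmetric] by (rule SUP_upper[OF that])
    finally show ?thesis using r(1) by simp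
  qed
  then show ?thesis by (auto intro!: bdd_aboveI2)
qed

lemma Metric_space_linf:
  assumes "A \<noteq> {}" and fin: "(SUP \<alpha>\<in>A. mdiameter (X \<alpha>)) < \<infinity>"
  shows "Metric_space (\<Pi>\<^sub>E \<alpha>\<in>A. mspace (X \<alpha>)) (linf_dist A X)"
proof
  let ?P = "\<Pi>\<^sub>E \<alpha>\<in>A. mspace (X \<alpha>)"
  have up: "mdist (X \<alpha>) (x \<alpha>) (y \<alpha>) \<le> linf_dist A X x y"
    if "x \<in> ?P" "y \<in> ?P" "\<alpha> \<in> A" for x y \<alpha>
    using cSUP_upper[OF that(3) bdd_above_linf[OF fin that(1,2)]] that(1,2)
    by (simp add: linf_dist_def)
  show nn: "0 \<le> linf_dist A X x y" for x y
  proof (cases "x \<in> ?P \<and> y \<in> ?P")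
    case True
    obtain \<alpha> where "\<alpha> \<in> A" using assms(1) by auto
    then show ?thesis using up[of x y \<alpha>] True mdist_nonneg[of "X \<alpha>" "x \<alpha>" "y \<alpha>"] by linarith
  qed (auto simp: linf_dist_def)
  show "linf_dist A X x y = linf_dist A X y x" for x y
    unfolding linf_dist_def by (subst conj_commute, subst mdist_commute) (rule refl)
  show "linf_dist A X x y = 0 \<longleftrightarrow> x = y" if xy: "x \<in> ?P" "y \<in> ?P" for x y
  proof
    assume 0: "linf_dist A X x y = 0"
    have "x \<alpha> = y \<alpha>" if "\<alpha> \<in> A" for \<alpha>
    proof -
      have "mdist (X \<alpha>) (x \<alpha>) (y \<alpha>) = 0"
        using up[OF xy that] 0 mdist_nonneg[of "X \<alpha>" "x \<alpha>" "y \<alpha>"] by linarith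
      then show ?thesis using mdist_zero[OF PiE_mem[OF xy(1) that] PiE_mem[OF xy(2) that]] by simp
    qed
    then show "x = y" by (rule PiE_ext[OF xy])
  next
    assume "x = y"
    have "(SUP \<alpha>\<in>A. mdist (X \<alpha>) (x \<alpha>) (x \<alpha>)) = (SUP \<alpha>\<in>A. (0::real))"
      by (intro SUP_cong refl) (simp add: mdist_zero[OF PiE_mem[OF xy(1)] PiE_mem[OF xy(1)]])
    then show "linf_dist A X x y = 0"
      using \<open>x = y\<close> assms(1) xy by (simp add: linf_dist_def)
  qed
  show "linf_dist A X x z \<le> linf_dist A X x y + linf_dist A X y z"
    if "x \<in> ?P" "y \<in> ?P" "z \<in> ?P" for x y z
  proof -
    have "mdist (X \<alpha>) (x \<alpha>) (z \<alpha>) \<le> linf_dist A X x y + linf_dist A X y z"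
      if "\<alpha> \<in> A" for \<alpha>
    proof -
      have "mdist (X \<alpha>) (x \<alpha>) (z \<alpha>) \<le> mdist (X \<alpha>) (x \<alpha>) (y \<alpha>) + mdist (X \<alpha>) (y \<alpha>) (z \<alpha>)"
        using \<open>x \<in> ?P\<close> \<open>y \<in> ?P\<close> \<open>z \<in> ?P\<close> that by (intro mdist_triangle) auto
      then show ?thesis
        using up[OF \<open>x \<in> ?P\<close> \<open>y \<in> ?P\<close> that] up[OF \<open>y \<in> ?P\<close> \<open>z \<in> ?P\<close> that] by linarith
    qed
    then show ?thesis
      using that assms(1) by (auto simp: linf_dist_def[of A X x z] intro!: cSUP_least)
  qed
qed

lemma mspace_linf_product:
  assumes "A \<noteq> {}" and "(SUP \<alpha>\<in>A. mdiameter (X \<alpha>)) < \<infinity>"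
  shows "mspace (linf_product A X) = (\<Pi>\<^sub>E \<alpha>\<in>A. mspace (X \<alpha>))"
  using Metric_space.mspace_metric[OF Metric_space_linf[OF assms]] by (simp add: linf_product_def)

lemma mdist_linf_product:
  assumes "A \<noteq> {}" and "(SUP \<alpha>\<in>A. mdiameter (X \<alpha>)) < \<infinity>"
    and "x \<in> (\<Pi>\<^sub>E \<alpha>\<in>A. mspace (X \<alpha>))" and "y \<in> (\<Pi>\<^sub>E \<alpha>\<in>A. mspace (X \<alpha>))"
  shows "mdist (linf_product A X) x y = (SUP \<alpha>\<in>A. mdist (X \<alpha>) (x \<alpha>) (y \<alpha>))"
  using Metric_space.mdist_metric[OF Metric_space_linf[OF assms(1,2)]] assms(3,4)
  by (simp add: linf_product_def linf_dist_def)

end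

theory Submission
  imports Defs
begin

text \<open>
  Both inequalities compare correspondences of the factors with correspondences of the products.

  For the upper bound, choose for every \<open>\<alpha>\<close> a nearly optimal correspondence \<open>R \<alpha>\<close> between
  \<open>X \<alpha>\<close> and \<open>Y \<alpha>\<close>, with the same error \<open>\<epsilon>\<close> for all \<open>\<alpha>\<close>. Relating two points of the products when
  all their coordinates are related gives a correspondence whose distortion is at most the
  supremum of the distortions of the \<open>R \<alpha>\<close>, because two suprema differ at most as much as
  their terms (\<open>abs_cSUP_diff_le\<close>).

  For the lower bound, a correspondence \<open>R\<close> between the products projects to a
  correspondence between \<open>X \<alpha>\<close> and \<open>Y \<alpha>\<close>. The product distance of two points lies between the distance
  of their \<open>\<alpha>\<close>-coordinates and that distance plus the largest diameter of the other factors
  (\<open>mdist_linf_product_le\<close>), so projecting raises the distortion by at most the larger of the two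
  suprema of diameters (\<open>distortion_projection_le\<close>). Bounding this maximum by the sum gives the claim.
\<close>

section \<open>Distortion and suprema\<close>

lemma ennreal_mdist_le_mdiameter:
  assumes "x \<in> mspace X" "x' \<in> mspace X"
  shows "ennreal (mdist X x x') \<le> mdiameter X"
  unfolding mdiameter_def using assms by (intro SUP_upper2[of "(x, x')"]) auto

lemma distortion_upper:
  assumes "(x, y) \<in> R" "(x', y') \<in> R"
  shows "ennreal \<bar>mdist X x x' - mdist Y y y'\<bar> \<le> distortion X Y R"
  unfolding distortion_def using assms by (intro SUP_upper2[of "((x, y), (x', y'))"]) auto

lemma distortion_least:
  assumes "\<And>x y x' y'. (x, y) \<in> R \<Longrightarrow> (x', y') \<in> R \<Longrightarrow>
             ennreal \<bar>mdist X x x' - mdist Y y y'\<bar> \<le> c"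
  shows "distortion X Y R \<le> c"
  unfolding distortion_def using assms by (intro SUP_least) auto

lemma ennreal_half_le_iff: "x / 2 \<le> c \<longleftrightarrow> x \<le> 2 * (c::ennreal)"
proof
  assume "x / 2 \<le> c"
  then have "2 * (x / 2) \<le> 2 * c" by (rule mult_left_mono) simp
  then show "x \<le> 2 * c" by (simp add: ennreal_times_divide mult_divide_eq_ennreal mult.commute)
next
  assume "x \<le> 2 * c"
  then have "x / 2 \<le> (2 * c) / 2" by (rule divide_right_mono_ennreal)
  then show "x / 2 \<le> c" by (simp add: mult_divide_eq_ennreal mult.commute)
qed

lemma ennreal_less_add_pos: "c < top \<Longrightarrow> 0 < \<epsilon> \<Longrightarrow> c < c + ennreal \<epsilon>"
  by (cases c rule: ennreal_cases) (auto simp: ennreal_less_iff simp flip: ennreal_plus)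

lemma gromov_hausdorff_dist_le:
  assumes "R \<in> correspondences X Y" "distortion X Y R \<le> 2 * c"
  shows "gromov_hausdorff_dist X Y \<le> c"
  unfolding gromov_hausdorff_dist_def ennreal_half_le_iff
  using assms by (rule INF_lower2)

lemma gromov_hausdorff_dist_lessE:
  assumes "gromov_hausdorff_dist X Y < c"
  obtains R where "R \<in> correspondences X Y" "distortion X Y R < 2 * c"
proof -
  have "\<not> 2 * c \<le> (INF R \<in> correspondences X Y. distortion X Y R)"
  proof
    assume "2 * c \<le> (INF R \<in> correspondences X Y. distortion X Y R)"
    then have "(2 * c) / 2 \<le> gromov_hausdorff_dist X Y"
      unfolding gromov_hausdorff_dist_def by (rule divide_right_mono_ennreal)
    then show False using assms by (simp add: mult_divide_eq_ennreal mult.commute)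
  qed
  then show thesis using that by (auto simp: not_le INF_less_iff)
qed

lemma correspondences_linf_productD:
  assumes "R \<in> correspondences (linf_product A X) (linf_product A Y)" "(x, y) \<in> R"
    and "A \<noteq> {}"
    and "(SUP \<alpha>\<in>A. mdiameter (X \<alpha>)) < \<infinity>" "(SUP \<alpha>\<in>A. mdiameter (Y \<alpha>)) < \<infinity>"
  shows "x \<in> (\<Pi>\<^sub>E \<alpha>\<in>A. mspace (X \<alpha>))" "y \<in> (\<Pi>\<^sub>E \<alpha>\<in>A. mspace (Y \<alpha>))"
  using assms(1,2) mspace_linf_product[OF assms(3,4)] mspace_linf_product[OF assms(3,5)]
  unfolding correspondences_def by blast+

text \<open>Taking suprema is 1-Lipschitz for the uniform distance.\<close>

lemma abs_cSUP_diff_le: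
  fixes f g :: "'i \<Rightarrow> real"
  assumes "A \<noteq> {}" and f: "bdd_above (f ` A)" and g: "bdd_above (g ` A)"
    and le: "\<And>i. i \<in> A \<Longrightarrow> \<bar>f i - g i\<bar> \<le> t"
  shows "\<bar>(SUP i\<in>A. f i) - (SUP i\<in>A. g i)\<bar> \<le> t"
proof -
  have "f i \<le> (SUP i\<in>A. g i) + t" "g i \<le> (SUP i\<in>A. f i) + t" if "i \<in> A" for i
    using cSUP_upper[OF that f] cSUP_upper[OF that g] le[OF that] by linarith+
  then have "(SUP i\<in>A. f i) \<le> (SUP i\<in>A. g i) + t" "(SUP i\<in>A. g i) \<le> (SUP i\<in>A. f i) + t"
    using assms(1) by (auto intro!: cSUP_least)
  then show ?thesis by linarith
qed


section \<open>The product correspondence\<close>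

text \<open>
  Extensionality cuts the related functions down to points of the product spaces, whose carriers consist
  of extensional functions.
\<close>

definition product_correspondence ::
    "'i set \<Rightarrow> ('i \<Rightarrow> ('a \<times> 'b) set) \<Rightarrow> (('i \<Rightarrow> 'a) \<times> ('i \<Rightarrow> 'b)) set" where
  "product_correspondence A R =
     {(x, y). x \<in> extensional A \<and> y \<in> extensional A \<and> (\<forall>\<alpha>\<in>A. (x \<alpha>, y \<alpha>) \<in> R \<alpha>)}"

lemma product_correspondence_in_correspondences:
  assumes "A \<noteq> {}"
    and "(SUP \<alpha>\<in>A. mdiameter (X \<alpha>)) < \<infinity>" "(SUP \<alpha>\<in>A. mdiameter (Y \<alpha>)) < \<infinity>"
    and R: "\<And>\<alpha>. \<alpha> \<in> A \<Longrightarrow> R \<alpha> \<in> correspondences (X \<alpha>) (Y \<alpha>)"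
  shows "product_correspondence A R \<in> correspondences (linf_product A X) (linf_product A Y)"
proof -
  let ?P = "product_correspondence A R"
  have sub: "R \<alpha> \<subseteq> mspace (X \<alpha>) \<times> mspace (Y \<alpha>)"
    and fst: "fst ` R \<alpha> = mspace (X \<alpha>)" and snd: "snd ` R \<alpha> = mspace (Y \<alpha>)" if "\<alpha> \<in> A" for \<alpha>
    using R[OF that] by (auto simp: correspondences_def)
  have P: "?P \<subseteq> (\<Pi>\<^sub>E \<alpha>\<in>A. mspace (X \<alpha>)) \<times> (\<Pi>\<^sub>E \<alpha>\<in>A. mspace (Y \<alpha>))"
  proof clarify
    fix x y assume xy: "(x, y) \<in> ?P"
    then have "x \<alpha> \<in> mspace (X \<alpha>) \<and> y \<alpha> \<in> mspace (Y \<alpha>)" if "\<alpha> \<in> A" for \<alpha>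
      using sub[OF that] that by (auto simp: product_correspondence_def)
    then show "x \<in> (\<Pi>\<^sub>E \<alpha>\<in>A. mspace (X \<alpha>)) \<and> y \<in> (\<Pi>\<^sub>E \<alpha>\<in>A. mspace (Y \<alpha>))"
      using xy by (simp add: PiE_iff product_correspondence_def)
  qed
  have X: "x \<in> fst ` ?P" if x: "x \<in> (\<Pi>\<^sub>E \<alpha>\<in>A. mspace (X \<alpha>))" for x
  proof -
    have "\<forall>\<alpha>\<in>A. \<exists>b. (x \<alpha>, b) \<in> R \<alpha>"
      using PiE_mem[OF x] fst by force
    then obtain y where "\<forall>\<alpha>\<in>A. (x \<alpha>, y \<alpha>) \<in> R \<alpha>" by metis
    then have "(x, restrict y A) \<in> ?P"
      using x by (auto simp: product_correspondence_def PiE_iff)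
    then show ?thesis by (rule rev_image_eqI) simp
  qed
  have Y: "y \<in> snd ` ?P" if y: "y \<in> (\<Pi>\<^sub>E \<alpha>\<in>A. mspace (Y \<alpha>))" for y
  proof -
    have "\<forall>\<alpha>\<in>A. \<exists>a. (a, y \<alpha>) \<in> R \<alpha>"
      using PiE_mem[OF y] snd by force
    then obtain x where "\<forall>\<alpha>\<in>A. (x \<alpha>, y \<alpha>) \<in> R \<alpha>" by metis
    then have "(restrict x A, y) \<in> ?P"
      using y by (auto simp: product_correspondence_def PiE_iff)
    then show ?thesis by (rule rev_image_eqI) simp
  qed
  have "fst ` ?P = (\<Pi>\<^sub>E \<alpha>\<in>A. mspace (X \<alpha>))"
  proof (intro equalityI subsetI X)
    show "x \<in> (\<Pi>\<^sub>E \<alpha>\<in>A. mspace (X \<alpha>))" if "x \<in> fst ` ?P" for x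
      using that subsetD[OF P] by (elim imageE) (metis mem_Times_iff)
  qed
  moreover have "snd ` ?P = (\<Pi>\<^sub>E \<alpha>\<in>A. mspace (Y \<alpha>))"
  proof (intro equalityI subsetI Y)
    show "y \<in> (\<Pi>\<^sub>E \<alpha>\<in>A. mspace (Y \<alpha>))" if "y \<in> snd ` ?P" for y
      using that subsetD[OF P] by (elim imageE) (metis mem_Times_iff)
  qed
  ultimately show ?thesis
    using P unfolding correspondences_def
      mspace_linf_product[OF assms(1,2)] mspace_linf_product[OF assms(1,3)] by simp
qed

lemma distortion_product_correspondence_le:
  assumes "A \<noteq> {}"
    and fin: "(SUP \<alpha>\<in>A. mdiameter (X \<alpha>)) < \<infinity>" "(SUP \<alpha>\<in>A. mdiameter (Y \<alpha>)) < \<infinity>"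
    and R: "\<And>\<alpha>. \<alpha> \<in> A \<Longrightarrow> R \<alpha> \<in> correspondences (X \<alpha>) (Y \<alpha>)"
  shows "distortion (linf_product A X) (linf_product A Y) (product_correspondence A R)
           \<le> (SUP \<alpha>\<in>A. distortion (X \<alpha>) (Y \<alpha>) (R \<alpha>))"
proof (cases "SUP \<alpha>\<in>A. distortion (X \<alpha>) (Y \<alpha>) (R \<alpha>)" rule: ennreal_cases)
  case (real t)
  have "product_correspondence A R \<in> correspondences (linf_product A X) (linf_product A Y)"
    using assms by (rule product_correspondence_in_correspondences)
  note P = correspondences_linf_productD[OF this _ assms(1) fin]
  show ?thesis
  proof (rule distortion_least)
    fix x y x' y'
    assume xy: "(x, y) \<in> product_correspondence A R" and xy': "(x', y') \<in> product_correspondence A R"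
    have mem: "x \<in> (\<Pi>\<^sub>E \<alpha>\<in>A. mspace (X \<alpha>))" "x' \<in> (\<Pi>\<^sub>E \<alpha>\<in>A. mspace (X \<alpha>))"
        "y \<in> (\<Pi>\<^sub>E \<alpha>\<in>A. mspace (Y \<alpha>))" "y' \<in> (\<Pi>\<^sub>E \<alpha>\<in>A. mspace (Y \<alpha>))"
      using P[OF xy] P[OF xy'] by blast+
    have "\<bar>mdist (X \<alpha>) (x \<alpha>) (x' \<alpha>) - mdist (Y \<alpha>) (y \<alpha>) (y' \<alpha>)\<bar> \<le> t" if "\<alpha> \<in> A" for \<alpha>
    proof -
      have "ennreal \<bar>mdist (X \<alpha>) (x \<alpha>) (x' \<alpha>) - mdist (Y \<alpha>) (y \<alpha>) (y' \<alpha>)\<bar>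
              \<le> distortion (X \<alpha>) (Y \<alpha>) (R \<alpha>)"
        using xy xy' that by (intro distortion_upper) (auto simp: product_correspondence_def)
      also have "\<dots> \<le> ennreal t"
        unfolding real(2)[symmetric] using that by (rule SUP_upper)
      finally show ?thesis using real(1) by simp
    qed
    then have "\<bar>mdist (linf_product A X) x x' - mdist (linf_product A Y) y y'\<bar> \<le> t"
      using mem assms(1) fin
      by (simp add: mdist_linf_product abs_cSUP_diff_le bdd_above_linf)
    then show "ennreal \<bar>mdist (linf_product A X) x x' - mdist (linf_product A Y) y y'\<bar>
                 \<le> (SUP \<alpha>\<in>A. distortion (X \<alpha>) (Y \<alpha>) (R \<alpha>))"
      unfolding real(2) by (rule ennreal_leI)
  qed
next
  case top
  show ?thesis unfolding top by (rule top_greatest)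
qed

text \<open>
  The infimum defining the distance need not be attained, hence the error \<open>\<epsilon>\<close>; it can be the same for
  all factors, so it survives the supremum unchanged.
\<close>

lemma gromov_hausdorff_dist_linf_product_le:
  assumes "A \<noteq> {}"
    and "(SUP \<alpha>\<in>A. mdiameter (X \<alpha>)) < \<infinity>" "(SUP \<alpha>\<in>A. mdiameter (Y \<alpha>)) < \<infinity>"
  shows "gromov_hausdorff_dist (linf_product A X) (linf_product A Y)
           \<le> (SUP \<alpha>\<in>A. gromov_hausdorff_dist (X \<alpha>) (Y \<alpha>))" (is "_ \<le> ?s")
proof (rule ennreal_le_epsilon)
  fix \<epsilon> :: real
  assume "?s < top" "0 < \<epsilon>"
  have "\<exists>R. R \<in> correspondences (X \<alpha>) (Y \<alpha>) \<and> distortion (X \<alpha>) (Y \<alpha>) R < 2 * (?s + ennreal \<epsilon>)"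
    if "\<alpha> \<in> A" for \<alpha>
  proof -
    have "gromov_hausdorff_dist (X \<alpha>) (Y \<alpha>) \<le> ?s" using that by (rule SUP_upper)
    also have "?s < ?s + ennreal \<epsilon>"
      using \<open>?s < top\<close> \<open>0 < \<epsilon>\<close> by (rule ennreal_less_add_pos)
    finally show ?thesis by (meson gromov_hausdorff_dist_lessE)
  qed
  then obtain R where R: "\<And>\<alpha>. \<alpha> \<in> A \<Longrightarrow> R \<alpha> \<in> correspondences (X \<alpha>) (Y \<alpha>)"
    "\<And>\<alpha>. \<alpha> \<in> A \<Longrightarrow> distortion (X \<alpha>) (Y \<alpha>) (R \<alpha>) < 2 * (?s + ennreal \<epsilon>)" by metis
  have "distortion (linf_product A X) (linf_product A Y) (product_correspondence A R)
          \<le> (SUP \<alpha>\<in>A. distortion (X \<alpha>) (Y \<alpha>) (R \<alpha>))"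
    using assms R(1) by (rule distortion_product_correspondence_le)
  also have "\<dots> \<le> 2 * (?s + ennreal \<epsilon>)"
    using R(2) by (intro SUP_least) (rule less_imp_le)
  finally show "gromov_hausdorff_dist (linf_product A X) (linf_product A Y) \<le> ?s + ennreal \<epsilon>"
    using assms R(1)
    by (intro gromov_hausdorff_dist_le[OF product_correspondence_in_correspondences])
qed


section \<open>Projections of correspondences\<close>

definition projected_correspondence ::
    "'i \<Rightarrow> (('i \<Rightarrow> 'a) \<times> ('i \<Rightarrow> 'b)) set \<Rightarrow> ('a \<times> 'b) set" where
  "projected_correspondence \<alpha> R = (\<lambda>(x, y). (x \<alpha>, y \<alpha>)) ` R"

text \<open>
  Since no factor is empty, every point of a factor is a coordinate of some point of the product.
\<close>

lemma projected_correspondence_in_correspondences: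
  assumes A: "A \<noteq> {}" and \<alpha>: "\<alpha> \<in> A"
    and ne: "\<And>\<alpha>. \<alpha> \<in> A \<Longrightarrow> mspace (X \<alpha>) \<noteq> {}" "\<And>\<alpha>. \<alpha> \<in> A \<Longrightarrow> mspace (Y \<alpha>) \<noteq> {}"
    and fin: "(SUP \<alpha>\<in>A. mdiameter (X \<alpha>)) < \<infinity>" "(SUP \<alpha>\<in>A. mdiameter (Y \<alpha>)) < \<infinity>"
    and R: "R \<in> correspondences (linf_product A X) (linf_product A Y)"
  shows "projected_correspondence \<alpha> R \<in> correspondences (X \<alpha>) (Y \<alpha>)"
proof -
  have "fst ` R = (\<Pi>\<^sub>E \<alpha>\<in>A. mspace (X \<alpha>))" "snd ` R = (\<Pi>\<^sub>E \<alpha>\<in>A. mspace (Y \<alpha>))"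
    using R unfolding correspondences_def mspace_linf_product[OF A fin(1)]
      mspace_linf_product[OF A fin(2)] by simp_all
  moreover have "(\<lambda>x. x \<alpha>) ` (\<Pi>\<^sub>E \<alpha>\<in>A. mspace (X \<alpha>)) = mspace (X \<alpha>)"
      "(\<lambda>y. y \<alpha>) ` (\<Pi>\<^sub>E \<alpha>\<in>A. mspace (Y \<alpha>)) = mspace (Y \<alpha>)"
    using ne \<alpha> by (simp_all add: image_projection_PiE PiE_eq_empty_iff)
  moreover have "fst ` projected_correspondence \<alpha> R = (\<lambda>x. x \<alpha>) ` fst ` R"
      "snd ` projected_correspondence \<alpha> R = (\<lambda>y. y \<alpha>) ` snd ` R"
    by (simp_all add: projected_correspondence_def image_image case_prod_beta)
  ultimately have "fst ` projected_correspondence \<alpha> R = mspace (X \<alpha>)"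
      "snd ` projected_correspondence \<alpha> R = mspace (Y \<alpha>)"
    by simp_all
  then show ?thesis by (force simp: correspondences_def)
qed

lemma mdist_le_mdist_linf_product:
  assumes "(SUP \<alpha>\<in>A. mdiameter (X \<alpha>)) < \<infinity>" "\<alpha> \<in> A"
    and "x \<in> (\<Pi>\<^sub>E \<alpha>\<in>A. mspace (X \<alpha>))" "x' \<in> (\<Pi>\<^sub>E \<alpha>\<in>A. mspace (X \<alpha>))"
  shows "mdist (X \<alpha>) (x \<alpha>) (x' \<alpha>) \<le> mdist (linf_product A X) x x'"
  using assms cSUP_upper[OF assms(2) bdd_above_linf[OF assms(1,3,4)]]
  by (subst mdist_linf_product) auto

text \<open>
  The supremum of the coordinate distances is the larger of the \<open>\<alpha>\<close>-th one and those of the other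
  coordinates; both are nonnegative, so their sum bounds it.
\<close>

lemma mdist_linf_product_le:
  assumes fin: "(SUP \<alpha>\<in>A. mdiameter (X \<alpha>)) < \<infinity>" and \<alpha>: "\<alpha> \<in> A"
    and x: "x \<in> (\<Pi>\<^sub>E \<alpha>\<in>A. mspace (X \<alpha>))" "x' \<in> (\<Pi>\<^sub>E \<alpha>\<in>A. mspace (X \<alpha>))"
    and d: "(SUP \<beta>\<in>A - {\<alpha>}. mdiameter (X \<beta>)) \<le> ennreal d" "0 \<le> d"
  shows "mdist (linf_product A X) x x' \<le> mdist (X \<alpha>) (x \<alpha>) (x' \<alpha>) + d"
proof -
  have "mdist (X \<beta>) (x \<beta>) (x' \<beta>) \<le> mdist (X \<alpha>) (x \<alpha>) (x' \<alpha>) + d" if "\<beta> \<in> A" for \<beta>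
  proof (cases "\<beta> = \<alpha>")
    case False
    have "ennreal (mdist (X \<beta>) (x \<beta>) (x' \<beta>)) \<le> mdiameter (X \<beta>)"
      using x that by (intro ennreal_mdist_le_mdiameter) auto
    also have "\<dots> \<le> (SUP \<beta>\<in>A - {\<alpha>}. mdiameter (X \<beta>))"
      using that False by (intro SUP_upper) auto
    also have "\<dots> \<le> ennreal d" by (rule d(1))
    finally have "mdist (X \<beta>) (x \<beta>) (x' \<beta>) \<le> d" using d(2) by simp
    then show ?thesis using mdist_nonneg[of "X \<alpha>" "x \<alpha>" "x' \<alpha>"] by linarith
  qed (use d(2) in simp)
  then show ?thesis
    using fin x \<alpha> by (subst mdist_linf_product) (auto intro!: cSUP_least)
qed

text \<open>
  With \<open>\<delta>\<close> the distortion of \<open>R\<close>, a coordinate distance in \<open>X \<alpha>\<close> is at most the product distance in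
  the \<open>X\<close>-product, hence at most \<open>\<delta>\<close> plus the one in the \<open>Y\<close>-product, which exceeds the
  coordinate distance in \<open>Y \<alpha>\<close> by at most \<open>d\<close>; and symmetrically. Each direction uses the diameters
  of only one family, so one \<open>d\<close> bounding both suprema is paid only once.
\<close>

lemma distortion_projection_le:
  assumes A: "A \<noteq> {}" and \<alpha>: "\<alpha> \<in> A"
    and fin: "(SUP \<alpha>\<in>A. mdiameter (X \<alpha>)) < \<infinity>" "(SUP \<alpha>\<in>A. mdiameter (Y \<alpha>)) < \<infinity>"
    and R: "R \<in> correspondences (linf_product A X) (linf_product A Y)"
    and d: "(SUP \<beta>\<in>A - {\<alpha>}. mdiameter (X \<beta>)) \<le> ennreal d"
      "(SUP \<beta>\<in>A - {\<alpha>}. mdiameter (Y \<beta>)) \<le> ennreal d" "0 \<le> d"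
  shows "distortion (X \<alpha>) (Y \<alpha>) (projected_correspondence \<alpha> R)
           \<le> distortion (linf_product A X) (linf_product A Y) R + ennreal d"
proof (rule distortion_least)
  let ?D = "distortion (linf_product A X) (linf_product A Y) R"
  fix a b a' b'
  assume "(a, b) \<in> projected_correspondence \<alpha> R" "(a', b') \<in> projected_correspondence \<alpha> R"
  then obtain x y x' y' where xy: "(x, y) \<in> R" "(x', y') \<in> R"
    and ab: "a = x \<alpha>" "b = y \<alpha>" "a' = x' \<alpha>" "b' = y' \<alpha>"
    by (auto simp: projected_correspondence_def)
  have mem: "x \<in> (\<Pi>\<^sub>E \<alpha>\<in>A. mspace (X \<alpha>))" "x' \<in> (\<Pi>\<^sub>E \<alpha>\<in>A. mspace (X \<alpha>))"
      "y \<in> (\<Pi>\<^sub>E \<alpha>\<in>A. mspace (Y \<alpha>))" "y' \<in> (\<Pi>\<^sub>E \<alpha>\<in>A. mspace (Y \<alpha>))"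
    using correspondences_linf_productD[OF R xy(1) A fin] correspondences_linf_productD[OF R xy(2) A fin] by blast+
  let ?e = "\<bar>mdist (linf_product A X) x x' - mdist (linf_product A Y) y y'\<bar>"
  have "\<bar>mdist (X \<alpha>) a a' - mdist (Y \<alpha>) b b'\<bar> \<le> ?e + d"
    using mdist_le_mdist_linf_product[where X=X, OF fin(1) \<alpha> mem(1,2)]
      mdist_le_mdist_linf_product[where X=Y, OF fin(2) \<alpha> mem(3,4)]
      mdist_linf_product_le[where X=X, OF fin(1) \<alpha> mem(1,2) d(1,3)]
      mdist_linf_product_le[where X=Y, OF fin(2) \<alpha> mem(3,4) d(2,3)]
    unfolding ab by linarith
  then have "ennreal \<bar>mdist (X \<alpha>) a a' - mdist (Y \<alpha>) b b'\<bar> \<le> ennreal ?e + ennreal d"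
    using d(3) by (simp flip: ennreal_plus)
  also have "\<dots> \<le> ?D + ennreal d"
    using xy by (intro add_right_mono distortion_upper)
  finally show "ennreal \<bar>mdist (X \<alpha>) a a' - mdist (Y \<alpha>) b b'\<bar> \<le> ?D + ennreal d" .
qed

lemma gromov_hausdorff_dist_factor_le:
  assumes "A \<noteq> {}" "\<alpha> \<in> A"
    and "\<And>\<alpha>. \<alpha> \<in> A \<Longrightarrow> mspace (X \<alpha>) \<noteq> {}" "\<And>\<alpha>. \<alpha> \<in> A \<Longrightarrow> mspace (Y \<alpha>) \<noteq> {}"
    and "(SUP \<alpha>\<in>A. mdiameter (X \<alpha>)) < \<infinity>" "(SUP \<alpha>\<in>A. mdiameter (Y \<alpha>)) < \<infinity>"
    and d: "(SUP \<beta>\<in>A - {\<alpha>}. mdiameter (X \<beta>)) \<le> ennreal d"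
      "(SUP \<beta>\<in>A - {\<alpha>}. mdiameter (Y \<beta>)) \<le> ennreal d" "0 \<le> d"
  shows "gromov_hausdorff_dist (X \<alpha>) (Y \<alpha>)
           \<le> gromov_hausdorff_dist (linf_product A X) (linf_product A Y) + ennreal (d / 2)"
    (is "?l \<le> ?g + _")
proof (rule ennreal_le_epsilon)
  fix \<epsilon> :: real
  assume "?g + ennreal (d / 2) < top" "0 < \<epsilon>"
  then have "?g < ?g + ennreal \<epsilon>"
    by (intro ennreal_less_add_pos) (auto simp: less_top ennreal_add_less_top)
  then obtain R where R: "R \<in> correspondences (linf_product A X) (linf_product A Y)"
    and dis: "distortion (linf_product A X) (linf_product A Y) R < 2 * (?g + ennreal \<epsilon>)"
    by (rule gromov_hausdorff_dist_lessE)
  have "distortion (X \<alpha>) (Y \<alpha>) (projected_correspondence \<alpha> R)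
          \<le> distortion (linf_product A X) (linf_product A Y) R + ennreal d"
    using assms(1,2,5,6) R d by (rule distortion_projection_le)
  also have "\<dots> \<le> 2 * (?g + ennreal \<epsilon>) + ennreal d"
    using dis by (intro add_right_mono) (rule less_imp_le)
  also have "ennreal d = 2 * ennreal (d / 2)"
    using d(3) by (simp flip: ennreal_numeral ennreal_mult'')
  finally have "distortion (X \<alpha>) (Y \<alpha>) (projected_correspondence \<alpha> R)
                  \<le> 2 * (?g + ennreal (d / 2) + ennreal \<epsilon>)"
    by (simp add: distrib_left ac_simps)
  moreover have "projected_correspondence \<alpha> R \<in> correspondences (X \<alpha>) (Y \<alpha>)"
    using assms(1-6) R by (rule projected_correspondence_in_correspondences)
  ultimately show "?l \<le> ?g + ennreal (d / 2) + ennreal \<epsilon>"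
    by (intro gromov_hausdorff_dist_le)
qed


section \<open>The two-sided estimate\<close>

theorem theorem2p8:
  fixes A :: "'i set" and X :: "'i \<Rightarrow> 'a metric" and Y :: "'i \<Rightarrow> 'b metric"
  assumes "A \<noteq> {}"
    and "\<And>\<alpha>. \<alpha> \<in> A \<Longrightarrow> mspace (X \<alpha>) \<noteq> {}"
    and "\<And>\<alpha>. \<alpha> \<in> A \<Longrightarrow> mspace (Y \<alpha>) \<noteq> {}"
    and "(SUP \<alpha>\<in>A. mdiameter (X \<alpha>)) < \<infinity>"
    and "(SUP \<alpha>\<in>A. mdiameter (Y \<alpha>)) < \<infinity>"
  shows "(SUP \<alpha>\<in>A. enn2ereal (gromov_hausdorff_dist (X \<alpha>) (Y \<alpha>))
            - enn2ereal (SUP \<beta>\<in>A - {\<alpha>}. mdiameter (X \<beta>)) / 2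
            - enn2ereal (SUP \<beta>\<in>A - {\<alpha>}. mdiameter (Y \<beta>)) / 2)
          \<le> enn2ereal (gromov_hausdorff_dist (linf_product A X) (linf_product A Y)) \<and>
         gromov_hausdorff_dist (linf_product A X) (linf_product A Y)
          \<le> (SUP \<alpha>\<in>A. gromov_hausdorff_dist (X \<alpha>) (Y \<alpha>))"
proof (intro conjI SUP_least gromov_hausdorff_dist_linf_product_le assms)
  fix \<alpha> assume "\<alpha> \<in> A"
  let ?l = "gromov_hausdorff_dist (X \<alpha>) (Y \<alpha>)"
  let ?g = "gromov_hausdorff_dist (linf_product A X) (linf_product A Y)"
  have "(SUP \<beta>\<in>A - {\<alpha>}. mdiameter (X \<beta>)) \<le> (SUP \<beta>\<in>A. mdiameter (X \<beta>))"
       "(SUP \<beta>\<in>A - {\<alpha>}. mdiameter (Y \<beta>)) \<le> (SUP \<beta>\<in>A. mdiameter (Y \<beta>))"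
    by (intro SUP_subset_mono; simp)+
  then have "(SUP \<beta>\<in>A - {\<alpha>}. mdiameter (X \<beta>)) < top" "(SUP \<beta>\<in>A - {\<alpha>}. mdiameter (Y \<beta>)) < top"
    using assms(4,5) by auto
  then obtain p q where p: "0 \<le> p" "(SUP \<beta>\<in>A - {\<alpha>}. mdiameter (X \<beta>)) = ennreal p"
    and q: "0 \<le> q" "(SUP \<beta>\<in>A - {\<alpha>}. mdiameter (Y \<beta>)) = ennreal q"
    by (metis ennreal_cases less_irrefl)
  \<comment> \<open>the sum \<open>p + q\<close> is a common bound for both suprema\<close>
  have "?l \<le> ?g + ennreal ((p + q) / 2)"
    using p q by (intro gromov_hausdorff_dist_factor_le \<open>\<alpha> \<in> A\<close> assms) (simp_all flip: ennreal_plus)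
  then have "enn2ereal ?l \<le> enn2ereal (?g + ennreal ((p + q) / 2))"
    by (simp add: less_eq_ennreal.rep_eq)
  also have "\<dots> = enn2ereal ?g + ereal ((p + q) / 2)"
    using p(1) q(1) by (simp add: plus_ennreal.rep_eq)
  finally have "enn2ereal ?l \<le> enn2ereal ?g + ereal ((p + q) / 2)" .
  then show "enn2ereal ?l - enn2ereal (SUP \<beta>\<in>A - {\<alpha>}. mdiameter (X \<beta>)) / 2
            - enn2ereal (SUP \<beta>\<in>A - {\<alpha>}. mdiameter (Y \<beta>)) / 2 \<le> enn2ereal ?g"
    unfolding p(2) q(2) using p(1) q(1)
    by (cases "enn2ereal ?l"; cases "enn2ereal ?g") (auto simp: field_simps)
qed

end
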